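(* Fix $t \in \mathbb{N}$, let $m = m(n) := \binom{n}{\lfloor n/2 \rfloor}$, and let $s = s(n)$ be a sequence of positive integers such that $m/n^t \ll s \ll m/n^{t-1}$ as $n \to \infty$. Then the number of antichains of size exactly $s$ in $\mathcal{P}(n)$ is $\binom{(t+o(1))m}{s}$. That is, for every $\delta > 0$ and all sufficiently large $n$, the number of antichains of size $s$ in $\mathcal{P}(n)$ is at least $\binom{(t-\delta)m}{s}$ and at most $\binom{(t+\delta)m}{s}$.
   Context: $\mathbb{N} = \{1,2,\dots\}$. For $n \in \mathbb{N}$, $[n] = \{1,\dots,n\}$ and $\mathcal{P}(n)$ denotes the power set of $[n]$. A family $\mathcal{A} \subseteq \mathcal{P}(n)$ is an antichain if for any $A, B \in \mathcal{A}$ with $A \subseteq B$ we have $A = B$. For positive functions $a(n), b(n)$, the notation $a \ll b$ means $a(n)/b(n) \to 0$ as $n \to \infty$. The term $o(1)$ denotes a quantity tending to $0$ as $n \to \infty$ (with $t$ fixed). For real $x$ and a nonnegative integer $s$, $\binom{x}{s} = x(x-1)\cdots(x-s+1)/s!$.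
   Formalization: The lower bound binom((t-δ)m, s) is claimed only for 0 < δ ≤ t, since for larger δ the top argument is negative and the literal bound can fail (e.g. δ = 3t, s even, where binom(-2tm, s) = binom(2tm+s-1, s) exceeds the count). *)

theory Defs
  imports Complex_Main
begin

definition antichain :: "'a set set \<Rightarrow> bool" where
  "antichain \<A> \<longleftrightarrow> (\<forall>A\<in>\<A>. \<forall>B\<in>\<A>. A \<subseteq> B \<longrightarrow> A = B)"

definition num_antichains :: "nat \<Rightarrow> nat \<Rightarrow> nat" where
  "num_antichains n s = card {\<A>. \<A> \<subseteq> Pow {1..n} \<and> antichain \<A> \<and> card \<A> = s}"

definition central_binom :: "nat \<Rightarrow> nat" where
  "central_binom n = n choose (n div 2)"

text \<open>The relation \<open>a \<lless> b\<close> between positive functions of \<open>n\<close>. Only the values at large \<open>n\<close>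
  matter, so totalised division at \<open>n = 0\<close> plays no role.\<close>

definition much_less :: "(nat \<Rightarrow> real) \<Rightarrow> (nat \<Rightarrow> real) \<Rightarrow> bool" where
  "much_less a b \<longleftrightarrow> (\<lambda>n. a n / b n) \<longlonglongrightarrow> 0"

end

theory Submission
  imports Defs "HOL-Combinatorics.Multiset_Permutations" "HOL-Real_Asymp.Real_Asymp"
begin

text \<open>
  Lower bound: in the \<open>t\<close> middle layers, which contain \<open>(t - o(1)) m\<close> sets, every set is comparable
  to at most \<open>t n ^ (t - 1)\<close> others. Since \<open>s n ^ (t - 1) = o(m)\<close>, choosing \<open>s\<close> incomparable sets
  greedily leaves \<open>(t - o(1)) m\<close> options at each step.

  Upper bound: antichains are independent sets of the comparability graph. By a random maximal chain
  argument, a family of at least \<open>(r + \<epsilon>) m\<close> sets contains a member comparable to \<open>c n ^ r\<close>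
  others. Let \<open>Z U\<close> be the sum of \<open>\<mu> ^ card I\<close> over independent \<open>I \<subseteq> U\<close>. Branching on a vertex
  \<open>v\<close> of degree at least \<open>d\<close> shows that every vertex of \<open>U\<close> costs only a factor \<open>exp y\<close> as long as
  \<open>\<mu> \<le> y exp (y d)\<close>. This is used with \<open>r = t + 2\<close> while \<open>U\<close> has more than \<open>(t + 3) m\<close> members,
  then with \<open>r = t\<close> down to \<open>(t + \<epsilon>) m\<close> members, and from there on with the trivial bound
  \<open>exp (\<mu> card U)\<close>. For \<open>\<mu> = s / ((t + \<epsilon>) m)\<close> the first two phases contribute only
  \<open>exp (o(s))\<close>, so that the number of antichains of size \<open>s\<close> is at most
  \<open>Z (Pow {1..n}) / \<mu> ^ s \<le> ((t + \<epsilon>) m exp (1 + o(1)) / s) ^ s\<close>.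
\<close>

section \<open>Supersaturation\<close>

text \<open>A permutation encodes a maximal chain, namely the chain of its prefix sets. One passing
  through \<open>B\<close> splits uniquely into an ordering of \<open>B\<close> and one of
  \<open>S - B\<close>. The predicate \<open>Q\<close> allows a second set to be imposed inside the
  prefix.\<close>

lemma card_permutations_with_prefix:
  assumes S: "finite S" "B \<subseteq> S"
  shows "card {xs \<in> permutations_of_set S. set (take (card B) xs) = B \<and> Q (take (card B) xs)}
       = card {ys \<in> permutations_of_set B. Q ys} * fact (card (S - B))"
proof -
  have fB: "finite B" using S finite_subset by blast
  have eq: "{xs \<in> permutations_of_set S. set (take (card B) xs) = B \<and> Q (take (card B) xs)}
      = (\<lambda>(ys, zs). ys @ zs) ` ({ys \<in> permutations_of_set B. Q ys} \<times> permutations_of_set (S - B))"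
    (is "?L = ?f ` ?R")
  proof (intro equalityI subsetI)
    fix xs assume xs: "xs \<in> ?L"
    let ?k = "card B"
    have d: "distinct (take ?k xs @ drop ?k xs)" and s: "set (take ?k xs @ drop ?k xs) = S"
      using xs by (simp_all add: permutations_of_set_def del: distinct_append set_append)
    have "set (drop ?k xs) = S - B" using d s xs unfolding set_append distinct_append by blast
    then have "(take ?k xs, drop ?k xs) \<in> ?R"
      using xs d by (auto simp: permutations_of_set_def)
    then have "?f (take ?k xs, drop ?k xs) \<in> ?f ` ?R" by (rule imageI)
    then show "xs \<in> ?f ` ?R" by simp
  next
    fix xs assume "xs \<in> ?f ` ?R"
    then obtain ys zs where x: "xs = ys @ zs" "ys \<in> permutations_of_set B" "Q ys"
      "zs \<in> permutations_of_set (S - B)" by auto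
    have "length ys = card B" using x(2) by (rule length_finite_permutations_of_set)
    then show "xs \<in> ?L" using x S by (auto simp: permutations_of_set_def)
  qed
  have "inj_on ?f ?R"
  proof (rule inj_onI)
    fix p q assume p: "p \<in> ?R" and q: "q \<in> ?R" and e: "?f p = ?f q"
    have "length (fst p) = length (fst q)"
      using p q by (auto dest!: length_finite_permutations_of_set)
    then show "p = q" using e by (auto simp: case_prod_unfold prod_eq_iff)
  qed
  then show ?thesis
    using S fB by (simp add: eq card_image card_cartesian_product)
qed

lemma card_permutations_through:
  assumes "finite S" "B \<subseteq> S"
  shows "card {xs \<in> permutations_of_set S. set (take (card B) xs) = B}
       = fact (card B) * fact (card S - card B)"
  using card_permutations_with_prefix[OF assms, of "\<lambda>_. True"] assms finite_subset[OF assms(2,1)]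
  by (simp add: card_Diff_subset)

text \<open>Among the chains through \<open>B\<close>, the proportion that also pass through
  \<open>A\<close> is the reciprocal of \<open>card B choose card A\<close>; the product form avoids
  division of naturals.\<close>

lemma card_permutations_through_pair:
  assumes S: "finite S" "B \<subseteq> S" and A: "A \<subseteq> B"
  shows "card {xs \<in> permutations_of_set S. set (take (card A) xs) = A \<and> set (take (card B) xs) = B}
         * (card B choose card A) = fact (card B) * fact (card S - card B)"
proof -
  have fB: "finite B" using S finite_subset by blast
  have le: "card A \<le> card B" using A fB by (rule card_mono[rotated])
  have "{xs \<in> permutations_of_set S. set (take (card A) xs) = A \<and> set (take (card B) xs) = B}
      = {xs \<in> permutations_of_set S. set (take (card B) xs) = B
            \<and> set (take (card A) (take (card B) xs)) = A}"
    using le by (auto simp: min_def)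
  then have "card {xs \<in> permutations_of_set S. set (take (card A) xs) = A \<and> set (take (card B) xs) = B}
      = fact (card A) * fact (card B - card A) * fact (card S - card B)"
    using card_permutations_with_prefix[OF S, of "\<lambda>ys. set (take (card A) ys) = A"]
      card_permutations_through[OF fB A] S fB
    by (simp add: card_Diff_subset)
  then show ?thesis using binomial_fact_lemma[OF le] by (simp add: algebra_simps)
qed

text \<open>Members of \<open>X\<close> are prefix sets, hence nested and determined by their size.
  With \<open>A\<close> the smallest, at most \<open>t\<close> of them have size below
  \<open>card A + t\<close>, and each other one forms a counted pair with \<open>A\<close>.\<close>

lemma card_prefixes_le:
  fixes F :: "'a set set" and xs :: "'a list"
  assumes F: "finite F" and t: "t \<ge> 1"
  defines "X \<equiv> {B \<in> F. set (take (card B) xs) = B}"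
  shows "card X \<le> t + card {(B, A) \<in> X \<times> X. A \<subset> B \<and> card A + t \<le> card B}"
proof (cases "X = {}")
  case True
  then show ?thesis by simp
next
  case False
  have fX: "finite X" using F by (simp add: X_def)
  obtain A where A: "A \<in> X" "\<And>B. B \<in> X \<Longrightarrow> card A \<le> card B"
    using arg_min_if_finite(1)[OF fX False] arg_min_least[OF fX False] by blast
  let ?hi = "{B \<in> X. card A + t \<le> card B}" and ?lo = "{B \<in> X. card B < card A + t}"
  have "inj_on card ?lo" unfolding X_def by (rule inj_onI) (metis (mono_tags, lifting) mem_Collect_eq)
  moreover have "card ` ?lo \<subseteq> {card A..<card A + t}" using A(2) by auto
  ultimately have lo: "card ?lo \<le> t"
    using card_inj_on_le[of card ?lo "{card A..<card A + t}"] by simp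
  have sub: "A \<subset> B" if "B \<in> ?hi" for B
  proof -
    have "set (take (card A) xs) \<subseteq> set (take (card B) xs)"
      using that by (intro set_take_subset_set_take) simp
    then have "A \<subseteq> B" using A(1) that by (simp add: X_def)
    moreover have "card A \<noteq> card B" using that t by auto
    ultimately show ?thesis by blast
  qed
  have "card ?hi = card ((\<lambda>B. (B, A)) ` ?hi)" by (simp add: card_image inj_on_def)
  also have "\<dots> \<le> card {(B, A) \<in> X \<times> X. A \<subset> B \<and> card A + t \<le> card B}"
    by (rule card_mono) (use fX A(1) sub in \<open>auto intro: finite_subset[of _ "X \<times> X"]\<close>)
  finally have hi: "card ?hi \<le> card {(B, A) \<in> X \<times> X. A \<subset> B \<and> card A + t \<le> card B}" .
  have "X = ?lo \<union> ?hi" by auto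
  then have "card X \<le> card ?lo + card ?hi" using card_Un_le[of ?lo ?hi] by simp
  then show ?thesis using lo hi by linarith
qed

lemma binomial_ge_middle:
  assumes "t \<le> k" "k + t \<le> n"
  shows "n choose t \<le> n choose k"
proof (cases "2 * k \<le> n")
  case True
  then show ?thesis using assms by (intro binomial_mono) auto
next
  case False
  have "n choose t \<le> n choose (n - k)" using assms False by (intro binomial_mono) auto
  then show ?thesis using assms by (subst binomial_symmetric[of k n]) simp_all
qed

lemma sum_card_swap:
  assumes "finite A" "finite B"
  shows "(\<Sum>x\<in>A. card {y \<in> B. R x y}) = (\<Sum>y\<in>B. card {x \<in> A. R x y})"
  using sum.swap_restrict[OF assms, of "\<lambda>_ _. 1::nat" R] by simp

text \<open>
  Every member of \<open>F\<close> on a chain, except the lowest \<open>t\<close> of them, lies at least \<open>t\<close> levels above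
  the lowest one. Averaging this over the chains of prefixes of all permutations of \<open>S\<close> compares
  the weight of \<open>F\<close> with that of its comparable pairs, each of which has weight at most
  \<open>(t / a) ^ t\<close> times that of its upper set.
\<close>

lemma supersaturation:
  fixes D :: real
  assumes S: "finite S" and F: "F \<subseteq> Pow S" and t: "1 \<le> t" "t \<le> a"
    and low: "\<And>A. A \<in> F \<Longrightarrow> a \<le> card A"
    and deg: "\<And>B. B \<in> F \<Longrightarrow> real (card {A \<in> F. A \<subset> B}) \<le> D"
  shows "real (card F) * (1 - D / (real a / real t) ^ t) \<le> real t * real (central_binom (card S))"
proof (cases "1 - D / (real a / real t) ^ t \<le> 0")
  case True
  then have "real (card F) * (1 - D / (real a / real t) ^ t) \<le> 0"
    by (simp add: mult_nonneg_nonpos)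
  then show ?thesis by (smt (verit) of_nat_0_le_iff mult_nonneg_nonneg)
next
  case False
  let ?P = "permutations_of_set S" and ?n = "card S"
  let ?on = "\<lambda>xs B. set (take (card B) xs) = B"
  define K where "K = (real a / real t) ^ t"
  \<comment> \<open>This is the number of permutations having \<open>B\<close> as a prefix
    set.\<close>
  define w where "w B = (fact (card B) * fact (?n - card B) :: nat)" for B :: "'a set"
  define E where "E = {(B, A) \<in> F \<times> F. A \<subset> B \<and> card A + t \<le> card B}"
  have K0: "K > 0" using t by (simp add: K_def)
  have fF: "finite F" using F S by (meson finite_Pow_iff finite_subset)
  have fE: "finite E" using fF by (auto simp: E_def intro: finite_subset[of _ "F \<times> F"])
  \<comment> \<open>Incidences between permutations and members of \<open>F\<close> are counted in
    both orders.\<close>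
  have "(\<Sum>B\<in>F. w B) = (\<Sum>xs\<in>?P. card {B \<in> F. ?on xs B})"
    unfolding sum_card_swap[OF finite_permutations_of_set fF]
    by (rule sum.cong) (use F S in \<open>auto simp: w_def card_permutations_through\<close>)
  also have "\<dots> \<le> (\<Sum>xs\<in>?P. t + card {p \<in> E. ?on xs (snd p) \<and> ?on xs (fst p)})"
  proof (rule sum_mono)
    fix xs assume "xs \<in> ?P"
    have "{(B, A) \<in> {B \<in> F. ?on xs B} \<times> {B \<in> F. ?on xs B}. A \<subset> B \<and> card A + t \<le> card B}
      = {p \<in> E. ?on xs (snd p) \<and> ?on xs (fst p)}"
      by (auto simp: E_def)
    then show "card {B \<in> F. ?on xs B} \<le> t + card {p \<in> E. ?on xs (snd p) \<and> ?on xs (fst p)}"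
      using card_prefixes_le[OF fF t(1), of xs] by simp
  qed
  also have "\<dots> = fact ?n * t + (\<Sum>p\<in>E. card {xs \<in> ?P. ?on xs (snd p) \<and> ?on xs (fst p)})"
    using S by (simp add: sum.distrib sum_card_swap[OF finite_permutations_of_set fE])
  finally have "real (\<Sum>B\<in>F. w B) \<le> real (fact ?n * t
      + (\<Sum>p\<in>E. card {xs \<in> ?P. ?on xs (snd p) \<and> ?on xs (fst p)}))"
    by (rule of_nat_mono)
  then have 1: "(\<Sum>B\<in>F. real (w B)) \<le> fact ?n * real t
      + (\<Sum>p\<in>E. real (card {xs \<in> ?P. ?on xs (snd p) \<and> ?on xs (fst p)}))"
    by simp
  have "(\<Sum>p\<in>E. real (card {xs \<in> ?P. ?on xs (snd p) \<and> ?on xs (fst p)}))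
      \<le> (\<Sum>p\<in>E. real (w (fst p)) / K)"
  proof (rule sum_mono)
    fix p assume "p \<in> E"
    then obtain A B where p: "p = (B, A)" "A \<in> F" "B \<in> F" "A \<subset> B" "card A + t \<le> card B"
      by (auto simp: E_def)
    let ?c = "card {xs \<in> ?P. ?on xs (snd p) \<and> ?on xs (fst p)}"
    have c: "?c * (card B choose card A) = w B"
      using card_permutations_through_pair[OF S, of B A] p F by (auto simp: w_def)
    have a: "a \<le> card A" using low p by simp
    have "K \<le> (real (card B) / real t) ^ t"
      unfolding K_def using a p t by (intro power_mono divide_right_mono) auto
    also have "\<dots> \<le> real (card B choose t)"
      using p by (intro binomial_ge_n_over_k_pow_k) auto
    also have "\<dots> \<le> real (card B choose card A)"
      using p a t by (simp add: binomial_ge_middle)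
    finally have "real ?c * K \<le> real ?c * real (card B choose card A)"
      by (rule mult_left_mono) simp
    also have "\<dots> = real (w B)" unfolding c[symmetric] by simp
    finally show "real ?c \<le> real (w (fst p)) / K"
      using K0 p(1) by (simp add: pos_le_divide_eq)
  qed
  \<comment> \<open>Dropping the condition on the level gap leaves exactly the pairs that
    \<open>D\<close> controls.\<close>
  also have "\<dots> \<le> (\<Sum>p\<in>(SIGMA B:F. {A \<in> F. A \<subset> B}). real (w (fst p)) / K)"
    by (rule sum_mono2) (use fF K0 in \<open>auto simp: E_def\<close>)
  also have "\<dots> = (\<Sum>B\<in>F. \<Sum>A\<in>{A \<in> F. A \<subset> B}. real (w B) / K)"
    using fF by (subst sum.Sigma) (auto simp: case_prod_unfold)
  also have "\<dots> = (\<Sum>B\<in>F. real (card {A \<in> F. A \<subset> B}) * (real (w B) / K))" by simp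
  also have "\<dots> \<le> (\<Sum>B\<in>F. D * (real (w B) / K))"
    by (rule sum_mono, rule mult_right_mono) (use deg K0 in auto)
  also have "\<dots> = D / K * (\<Sum>B\<in>F. real (w B))" by (simp add: sum_distrib_left)
  finally have 2: "(\<Sum>B\<in>F. real (w B)) * (1 - D / K) \<le> fact ?n * real t"
    using 1 by (simp add: algebra_simps)
  have m0: "central_binom ?n > 0" by (simp add: central_binom_def)
  \<comment> \<open>As in the LYM inequality, every set has weight at least \<open>n! / m\<close>,
    because no binomial coefficient exceeds the central one.\<close>
  have "real (card F) * (fact ?n / real (central_binom ?n)) = (\<Sum>B\<in>F. fact ?n / real (central_binom ?n))"
    by simp
  also have "\<dots> \<le> (\<Sum>B\<in>F. real (w B))"
  proof (rule sum_mono)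
    fix B assume "B \<in> F"
    then have "card B \<le> ?n" using F S by (auto intro: card_mono)
    then have "fact ?n = real (w B) * real (?n choose card B)"
      using binomial_fact_lemma[of "card B" ?n] by (metis of_nat_fact of_nat_mult w_def)
    also have "\<dots> \<le> real (w B) * real (central_binom ?n)"
      unfolding central_binom_def by (intro mult_left_mono) (simp_all add: binomial_maximum)
    finally show "fact ?n / real (central_binom ?n) \<le> real (w B)"
      using m0 by (simp add: pos_divide_le_eq)
  qed
  finally have "real (card F) * (fact ?n / real (central_binom ?n)) * (1 - D / K) \<le> fact ?n * real t"
    using 2 False K_def by (smt (verit) mult_right_mono)
  then have "fact ?n * (real (card F) * (1 - D / K)) \<le> fact ?n * (real t * real (central_binom ?n))"
    using m0 by (simp add: field_simps)
  then show ?thesis unfolding K_def by (subst (asm) mult_le_cancel_left_pos) simp_all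
qed

section \<open>Layers far below the middle\<close>

lemma binomial_double:
  assumes "3 * k + 2 \<le> n"
  shows "2 * (n choose k) \<le> n choose Suc k"
proof -
  have "(2 * Suc k) * (n choose k) \<le> (n - k) * (n choose k)"
    using assms by (intro mult_right_mono) auto
  also have "\<dots> = Suc k * (n choose Suc k)"
    using binomial_absorb_comp[of n k] Suc_times_binomial_eq[of "n - 1" k] assms by simp
  finally have "Suc k * (2 * (n choose k)) \<le> Suc k * (n choose Suc k)" by (simp add: algebra_simps)
  then show ?thesis by (simp only: Suc_mult_le_cancel1)
qed

lemma card_subsets_less:
  assumes "finite S"
  shows "card {A. A \<subseteq> S \<and> card A < j} = (\<Sum>k<j. card S choose k)"
proof -
  have "{A. A \<subseteq> S \<and> card A < j} = (\<Union>k<j. {A. A \<subseteq> S \<and> card A = k})" by auto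
  also have "card \<dots> = (\<Sum>k<j. card {A. A \<subseteq> S \<and> card A = k})"
    using assms by (intro card_UN_disjoint) auto
  finally show ?thesis using assms by (simp add: n_subsets)
qed

text \<open>Binomial coefficients at least double from one layer to the next up to about
  \<open>n / 3\<close>, so the sum is dominated like a geometric series.\<close>

lemma sum_binomial_low:
  "3 * j \<le> n + 1 \<Longrightarrow> (\<Sum>k<j. n choose k) \<le> n choose j"
proof (induction j)
  case (Suc j)
  then show ?case using binomial_double[of j n] by simp
qed simp

lemma binomial_power2:
  "3 * (j + i) \<le> n + 1 \<Longrightarrow> 2 ^ i * (n choose j) \<le> n choose (j + i)"
proof (induction i)
  case (Suc i)
  then show ?case using binomial_double[of "j + i" n] by simp
qed simp

text \<open>The doubling persists for \<open>n div 12\<close> further steps above layer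
  \<open>n div 4\<close>, so the lower layers are smaller than the middle one by a factor of at
  least \<open>2 ^ (n div 12)\<close>.\<close>

lemma low_layers_negligible:
  assumes "\<eta> > 0"
  shows "\<forall>\<^sub>F n in sequentially. (\<Sum>k<n div 4. real (n choose k)) \<le> \<eta> * real (central_binom n)"
proof -
  obtain N :: nat where N: "1 / \<eta> \<le> real N" using real_arch_simple by blast
  show ?thesis
  proof (rule eventually_sequentiallyI[of "12 * N"])
    fix n assume n: "12 * N \<le> n"
    let ?S = "\<Sum>k<n div 4. n choose k"
    have "2 ^ (n div 12) * ?S \<le> 2 ^ (n div 12) * (n choose (n div 4))"
      using sum_binomial_low[of "n div 4" n] by simp
    also have "\<dots> \<le> n choose (n div 4 + n div 12)"
    proof (rule binomial_power2)
      have "12 * (n div 12) \<le> n" "4 * (n div 4) \<le> n" by (simp_all only: times_div_less_eq_dividend)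
      then show "3 * (n div 4 + n div 12) \<le> n + 1" unfolding distrib_left by linarith
    qed
    also have "\<dots> \<le> central_binom n" unfolding central_binom_def by (rule binomial_maximum)
    finally have "real (2 ^ (n div 12) * ?S) \<le> real (central_binom n)" by (rule of_nat_mono)
    then have 1: "2 ^ (n div 12) * real ?S \<le> real (central_binom n)" by simp
    have "N \<le> n div 12" using n by simp
    then have "real N \<le> real (n div 12)" by simp
    also have "\<dots> \<le> 2 ^ (n div 12)" by (simp add: less_imp_le of_nat_less_two_power)
    finally have "1 / \<eta> \<le> 2 ^ (n div 12)" using N by linarith
    then have "1 / \<eta> * real ?S \<le> 2 ^ (n div 12) * real ?S" by (rule mult_right_mono) (simp add: sum_nonneg)
    then have "1 / \<eta> * real ?S \<le> real (central_binom n)" using 1 by linarith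
    then show "(\<Sum>k<n div 4. real (n choose k)) \<le> \<eta> * real (central_binom n)"
      using assms by (simp add: field_simps)
  qed
qed

lemma central_binom_pos [simp]: "central_binom n > 0"
  by (simp add: central_binom_def)

text \<open>Discarding the layers below \<open>n div 4\<close> costs at most
  \<open>(\<epsilon> / 2) m\<close> sets. In what remains, \<open>supersaturation\<close> with
  \<open>a = n div 4\<close> has a denominator of order \<open>n ^ t\<close>, so degrees below a
  small multiple of \<open>n ^ t\<close> would leave too few sets.\<close>

lemma large_family_has_large_degree:
  assumes t: "t \<ge> 1" and \<epsilon>: "\<epsilon> > 0"
  obtains c :: real where "c > 0"
    "\<forall>\<^sub>F n in sequentially. \<forall>F. F \<subseteq> Pow {1..n} \<longrightarrow>
       (real t + \<epsilon>) * real (central_binom n) \<le> real (card F) \<longrightarrow>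
       (\<exists>B\<in>F. c * real n ^ t \<le> real (card {A \<in> F. A \<subset> B}))"
proof
  \<comment> \<open>Chosen so that \<open>(t + \<epsilon> / 2) (1 - r) = t + \<epsilon> / 4\<close>,
    which still exceeds \<open>t\<close>.\<close>
  define r where "r = \<epsilon> / 4 / (real t + \<epsilon> / 2)"
  \<comment> \<open>The 8 comes from \<open>n div 4 \<ge> n / 8\<close>, valid for the
    \<open>n\<close> considered; thus \<open>?c * n ^ t\<close> is at most
    \<open>r * K\<close>.\<close>
  let ?c = "r * (1 / (8 * real t)) ^ t"
  have r: "r > 0" using \<epsilon> by (simp add: r_def add_nonneg_pos)
  then show "?c > 0" using t by simp
  show "\<forall>\<^sub>F n in sequentially. \<forall>F. F \<subseteq> Pow {1..n} \<longrightarrow>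
       (real t + \<epsilon>) * real (central_binom n) \<le> real (card F) \<longrightarrow>
       (\<exists>B\<in>F. ?c * real n ^ t \<le> real (card {A \<in> F. A \<subset> B}))"
    using low_layers_negligible[OF half_gt_zero[OF \<epsilon>]] eventually_ge_at_top[of "8 * t"]
  proof eventually_elim
    case (elim n)
    show ?case
    proof (intro allI impI, rule ccontr)
      fix F assume F: "F \<subseteq> Pow {1..n}" and cF: "(real t + \<epsilon>) * real (central_binom n) \<le> real (card F)"
        and con: "\<not> (\<exists>B\<in>F. ?c * real n ^ t \<le> real (card {A \<in> F. A \<subset> B}))"
      let ?m = "real (central_binom n)"
      define G where "G = {A \<in> F. n div 4 \<le> card A}"
      define K where "K = (real (n div 4) / real t) ^ t"
      have fF: "finite F" using F by (meson finite_Pow_iff finite_atLeastAtMost finite_subset)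
      have "card F \<le> card (G \<union> {A. A \<subseteq> {1..n} \<and> card A < n div 4})"
        by (rule card_mono) (use fF F in \<open>auto simp: G_def\<close>)
      also have "\<dots> \<le> card G + (\<Sum>k<n div 4. n choose k)"
        using card_Un_le[of G "{A. A \<subseteq> {1..n} \<and> card A < n div 4}"]
        by (simp add: card_subsets_less)
      finally have "real (card F) \<le> real (card G + (\<Sum>k<n div 4. n choose k))" by (rule of_nat_mono)
      then have "real (card F) \<le> real (card G) + \<epsilon> / 2 * ?m" using elim(1) by simp
      then have cG: "(real t + \<epsilon> / 2) * ?m \<le> real (card G)" using cF by (simp add: algebra_simps)
      have "(real n / 8 / real t) ^ t \<le> K"
        unfolding K_def by (intro power_mono divide_right_mono) (use elim(2) t in \<open>linarith | simp\<close>)+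
      then have K: "(1 / (8 * real t)) ^ t * real n ^ t \<le> K"
        by (simp add: power_mult_distrib power_divide)
      have K0: "K > 0" using elim(2) t by (simp add: K_def div_greater_zero_iff)
      have "?c * real n ^ t \<le> r * K" using mult_left_mono[OF K, of r] r by (simp add: mult.assoc)
      then have "?c * real n ^ t / K \<le> r" using K0 by (simp add: pos_divide_le_eq)
      have "real (card G) * (1 - ?c * real n ^ t / K) \<le> real t * real (central_binom (card {1..n}))"
        unfolding K_def
      proof (rule supersaturation)
        fix B assume B: "B \<in> G"
        have "card {A \<in> G. A \<subset> B} \<le> card {A \<in> F. A \<subset> B}"
          by (rule card_mono) (use fF in \<open>auto simp: G_def\<close>)
        moreover have "real (card {A \<in> F. A \<subset> B}) \<le> ?c * real n ^ t"
          using con B by (auto simp: G_def not_le intro: less_imp_le)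
        ultimately show "real (card {A \<in> G. A \<subset> B}) \<le> ?c * real n ^ t" by linarith
      qed (use F t elim(2) in \<open>auto simp: G_def\<close>)
      then have 1: "real (card G) * (1 - ?c * real n ^ t / K) \<le> real t * ?m" by simp
      have r1: "1 - r \<ge> 0" using \<epsilon> by (simp add: r_def field_simps)
      have "(real t + \<epsilon> / 2) * ?m * (1 - r) \<le> real (card G) * (1 - ?c * real n ^ t / K)"
        using cG \<open>?c * real n ^ t / K \<le> r\<close> r1 by (intro mult_mono) auto
      then have "(real t + \<epsilon> / 2) * ?m * (1 - r) \<le> real t * ?m" using 1 by (rule order_trans)
      then have "(real t + \<epsilon> / 2) * (1 - r) * ?m \<le> real t * ?m"
        by (simp only: mult.assoc mult.commute[of ?m "1 - r"])
      then have "(real t + \<epsilon> / 2) * (1 - r) \<le> real t"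
        by (subst (asm) mult_le_cancel_right_pos) simp_all
      moreover have "(real t + \<epsilon> / 2) * (1 - r) = real t + \<epsilon> / 4"
      proof -
        have "real t + \<epsilon> / 2 \<noteq> 0" using \<epsilon> by (simp add: add_nonneg_eq_0_iff)
        then have "(real t + \<epsilon> / 2) * r = \<epsilon> / 4"
          unfolding r_def by (metis nonzero_mult_div_cancel_left times_divide_eq_right)
        then show ?thesis by (simp add: right_diff_distrib)
      qed
      ultimately show False using \<epsilon> by simp
    qed
  qed
qed

section \<open>Counting independent sets\<close>

text \<open>
  The relation \<open>P\<close> is non-adjacency, so that the independent sets are the \<open>P\<close>-cliques.
\<close>

definition indep_sets :: "('a \<Rightarrow> 'a \<Rightarrow> bool) \<Rightarrow> 'a set \<Rightarrow> 'a set set" where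
  "indep_sets P U = {I. I \<subseteq> U \<and> pairwise P I}"

text \<open>The independence polynomial of the graph induced on \<open>U\<close>, that is, the
  hard-core partition function at fugacity \<open>\<mu>\<close>.\<close>

definition indep_poly :: "('a \<Rightarrow> 'a \<Rightarrow> bool) \<Rightarrow> real \<Rightarrow> 'a set \<Rightarrow> real" where
  "indep_poly P \<mu> U = (\<Sum>I\<in>indep_sets P U. \<mu> ^ card I)"

lemma finite_indep_sets [simp]: "finite U \<Longrightarrow> finite (indep_sets P U)"
  by (simp add: indep_sets_def)

lemma indep_poly_empty [simp]: "indep_poly P \<mu> {} = 1"
proof -
  have "indep_sets P {} = {{}}" by (auto simp: indep_sets_def)
  then show ?thesis by (simp add: indep_poly_def)
qed

text \<open>Independent sets are split by whether they contain \<open>v\<close>; those that do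
  consist of \<open>v\<close> and an independent set of its non-neighbours.\<close>

lemma indep_poly_remove_vertex:
  assumes U: "finite U" and v: "v \<in> U" and \<mu>: "\<mu> \<ge> 0"
  shows "indep_poly P \<mu> U \<le> indep_poly P \<mu> (U - {v}) + \<mu> * indep_poly P \<mu> {u \<in> U - {v}. P v u}"
proof -
  let ?W = "{u \<in> U - {v}. P v u}"
  have inj: "inj_on (insert v) (indep_sets P ?W)"
    by (rule inj_onI) (auto simp: indep_sets_def)
  have fW: "finite (indep_sets P ?W)" using U by simp
  have "I \<in> indep_sets P (U - {v}) \<union> insert v ` indep_sets P ?W" if "I \<in> indep_sets P U" for I
  proof (cases "v \<in> I")
    case True
    then have "I - {v} \<in> indep_sets P ?W" "I = insert v (I - {v})"
      using that by (auto simp: indep_sets_def pairwise_def)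
    then show ?thesis by blast
  qed (use that in \<open>auto simp: indep_sets_def\<close>)
  then have "indep_poly P \<mu> U \<le> (\<Sum>I\<in>indep_sets P (U - {v}) \<union> insert v ` indep_sets P ?W. \<mu> ^ card I)"
    unfolding indep_poly_def using U \<mu> by (intro sum_mono2) auto
  also have "\<dots> \<le> indep_poly P \<mu> (U - {v}) + (\<Sum>I\<in>insert v ` indep_sets P ?W. \<mu> ^ card I)"
    unfolding indep_poly_def using U \<mu> by (subst sum_Un) (auto intro!: sum_nonneg)
  also have "(\<Sum>I\<in>insert v ` indep_sets P ?W. \<mu> ^ card I) = (\<Sum>I\<in>indep_sets P ?W. \<mu> * \<mu> ^ card I)"
    unfolding sum.reindex[OF inj]
  proof (rule sum.cong)
    fix I assume "I \<in> indep_sets P ?W"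
    then have "finite I" "v \<notin> I" using U by (auto simp: indep_sets_def intro: finite_subset)
    then show "((\<lambda>I. \<mu> ^ card I) \<circ> insert v) I = \<mu> * \<mu> ^ card I" by simp
  qed simp
  finally show ?thesis by (simp add: indep_poly_def sum_distrib_left)
qed

text \<open>While \<open>U\<close> is larger than \<open>M\<close>, branch on a vertex of degree at
  least \<open>d\<close>. Omitting it loses one vertex and choosing it loses at least
  \<open>d + 1\<close>. The bound on \<open>\<mu>\<close> makes the second branch at most
  \<open>y\<close> times the bound for the first, and \<open>1 + y \<le> exp y\<close>. Leaving the
  small sets to \<open>G\<close> lets the lemma be iterated with different degrees.\<close>

lemma indep_poly_le_exp:
  fixes \<mu> y d G M :: real
  assumes V: "finite V" and \<mu>: "0 \<le> \<mu>" "\<mu> \<le> y * exp (y * d)" and y: "0 \<le> y" and G: "0 \<le> G"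
    and base: "\<And>U. U \<subseteq> V \<Longrightarrow> real (card U) \<le> M \<Longrightarrow> indep_poly P \<mu> U \<le> G"
    and deg: "\<And>U. U \<subseteq> V \<Longrightarrow> M < real (card U) \<Longrightarrow>
        \<exists>v\<in>U. d \<le> real (card {u \<in> U - {v}. \<not> P v u})"
  shows "U \<subseteq> V \<Longrightarrow> indep_poly P \<mu> U \<le> G * exp (y * real (card U))"
proof (induction "card U" arbitrary: U rule: less_induct)
  case less
  show ?case
  proof (cases "real (card U) \<le> M")
    case True
    then have "indep_poly P \<mu> U \<le> G * 1" using base less.prems by simp
    also have "\<dots> \<le> G * exp (y * real (card U))" using G y by (intro mult_left_mono) auto
    finally show ?thesis .
  next
    case False
    then obtain v where v: "v \<in> U" "d \<le> real (card {u \<in> U - {v}. \<not> P v u})"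
      using deg less.prems by (metis not_le)
    have fU: "finite U" using V less.prems finite_subset by blast
    let ?N = "{u \<in> U - {v}. \<not> P v u}" and ?W = "{u \<in> U - {v}. P v u}"
    have "card (U - {v}) = card (?W \<union> ?N)" by (rule arg_cong[where f = card]) auto
    also have "\<dots> = card ?W + card ?N" using fU by (intro card_Un_disjoint) auto
    finally have W: "real (card ?W) = real (card U - 1) - real (card ?N)"
      using fU v(1) by simp
    have U0: "card U > 0" using v(1) fU by (auto simp: card_gt_0_iff)
    have "indep_poly P \<mu> (U - {v}) \<le> G * exp (y * real (card (U - {v})))"
      using less.prems U0 fU v(1) by (intro less.hyps) auto
    then have 1: "indep_poly P \<mu> (U - {v}) \<le> G * exp (y * real (card U - 1))"
      using fU v(1) by simp
    have "card ?W < card U" using fU v(1) by (intro psubset_card_mono) auto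
    then have "indep_poly P \<mu> ?W \<le> G * exp (y * real (card ?W))"
      using less.prems by (intro less.hyps) auto
    \<comment> \<open>The \<open>d\<close> lost neighbours give the factor
      \<open>exp (- y d)\<close> that cancels the one allowed in \<open>\<mu>\<close>.\<close>
    also have "\<dots> \<le> G * exp (y * (real (card U - 1) - d))"
      using W v(2) y G by (intro mult_left_mono) (auto intro: mult_left_mono)
    finally have "\<mu> * indep_poly P \<mu> ?W \<le> y * exp (y * d) * (G * exp (y * (real (card U - 1) - d)))"
      using \<mu> y G by (meson mult_left_mono mult_right_mono order_trans mult_nonneg_nonneg exp_ge_zero)
    also have "\<dots> = G * y * exp (y * real (card U - 1))"
      by (simp add: right_diff_distrib exp_diff)
    finally have "indep_poly P \<mu> U \<le> G * exp (y * real (card U - 1)) + G * y * exp (y * real (card U - 1))"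
      using indep_poly_remove_vertex[OF fU v(1) \<mu>(1), of P] 1 by linarith
    also have "\<dots> = G * exp (y * real (card U - 1)) * (1 + y)" by (simp add: algebra_simps)
    also have "\<dots> \<le> G * exp (y * real (card U - 1)) * exp y"
      using G by (intro mult_left_mono) (auto simp: exp_ge_add_one_self)
    also have "\<dots> = G * exp (y * real (card U))"
      using U0 by (simp add: mult.assoc exp_add[symmetric] of_nat_diff algebra_simps)
    finally show ?thesis .
  qed
qed

text \<open>The case \<open>d = 0\<close>, \<open>y = \<mu>\<close>, where the branching runs down
  to the empty set.\<close>

lemma indep_poly_le_exp_card:
  assumes "finite U" "\<mu> \<ge> 0"
  shows "indep_poly P \<mu> U \<le> exp (\<mu> * real (card U))"
proof -
  have "indep_poly P \<mu> U \<le> 1 * exp (\<mu> * real (card U))"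
  proof (rule indep_poly_le_exp[where d = 0 and M = 0 and V = U])
    fix W assume "W \<subseteq> U" "real (card W) \<le> 0"
    then have "W = {}" using assms(1) finite_subset by fastforce
    then show "indep_poly P \<mu> W \<le> 1" by simp
  next
    fix W assume "W \<subseteq> U" "0 < real (card W)"
    then show "\<exists>v\<in>W. 0 \<le> real (card {u \<in> W - {v}. \<not> P v u})" by (cases "W = {}") auto
  qed (use assms in auto)
  then show ?thesis by simp
qed

lemma count_indep_sets_le:
  assumes U: "finite U" and \<mu>: "\<mu> \<ge> 0"
  shows "real (card {I \<in> indep_sets P U. card I = s}) * \<mu> ^ s \<le> indep_poly P \<mu> U"
proof -
  have "real (card {I \<in> indep_sets P U. card I = s}) * \<mu> ^ s
      = (\<Sum>I\<in>{I \<in> indep_sets P U. card I = s}. \<mu> ^ card I)" by simp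
  also have "\<dots> \<le> indep_poly P \<mu> U"
    unfolding indep_poly_def using U \<mu> by (intro sum_mono2) auto
  finally show ?thesis .
qed

text \<open>Greedy choice: fewer than \<open>s\<close> chosen vertices block at most
  \<open>s D\<close> vertices, each blocking itself and its neighbours. Every set of size
  \<open>k\<close> can be built in \<open>k!\<close> orders, whence the factorial.\<close>

lemma count_indep_sets_ge:
  fixes D :: real
  assumes V: "finite V" and sym: "\<And>u v. P u v \<Longrightarrow> P v u"
    and deg: "\<And>v. v \<in> V \<Longrightarrow> real (card {u \<in> V. u = v \<or> \<not> P v u}) \<le> D"
    and D: "0 \<le> D" and s: "real s * D \<le> real (card V)"
  shows "k \<le> s \<Longrightarrow>
    (real (card V) - real s * D) ^ k \<le> fact k * real (card {I \<in> indep_sets P V. card I = k})"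
proof (induction k)
  case 0
  have "{I \<in> indep_sets P V. card I = 0} = {{}}"
    using V by (auto simp: indep_sets_def dest: finite_subset)
  then show ?case by simp
next
  case (Suc k)
  let ?I = "\<lambda>k. {I \<in> indep_sets P V. card I = k}"
  let ?x = "real (card V) - real s * D"
  define ext where "ext I = {v \<in> V - I. \<forall>u\<in>I. P u v}" for I
  have fI: "finite (?I j)" for j using V by simp
  have ext: "?x \<le> real (card (ext I))" if I: "I \<in> ?I k" for I
  proof -
    have IV: "I \<subseteq> V" "finite I" using I V by (auto simp: indep_sets_def dest: finite_subset)
    have "card V \<le> card (ext I \<union> (\<Union>v\<in>I. {u \<in> V. u = v \<or> \<not> P v u}))"
      using V IV by (intro card_mono) (auto simp: ext_def)
    also have "\<dots> \<le> card (ext I) + (\<Sum>v\<in>I. card {u \<in> V. u = v \<or> \<not> P v u})"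
      using card_UN_le[OF IV(2), of "\<lambda>v. {u \<in> V. u = v \<or> \<not> P v u}"]
      by (intro order_trans[OF card_Un_le]) simp
    finally have "real (card V) \<le> real (card (ext I) + (\<Sum>v\<in>I. card {u \<in> V. u = v \<or> \<not> P v u}))"
      by (rule of_nat_mono)
    then have "real (card V) \<le> real (card (ext I)) + (\<Sum>v\<in>I. real (card {u \<in> V. u = v \<or> \<not> P v u}))"
      by simp
    also have "(\<Sum>v\<in>I. real (card {u \<in> V. u = v \<or> \<not> P v u})) \<le> (\<Sum>v\<in>I. D)"
      using deg IV by (intro sum_mono) auto
    also have "\<dots> = real k * D" using I by simp
    also have "\<dots> \<le> real s * D"
      using D Suc.prems by (intro mult_right_mono) auto
    finally show ?thesis by linarith
  qed
  \<comment> \<open>Recording the added vertex makes an extension reversible. Each set of size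
    \<open>k + 1\<close> is then reached at most \<open>k + 1\<close> times, once per marked
    element.\<close>
  have inj: "inj_on (\<lambda>(I, v). (insert v I, v)) (Sigma (?I k) ext)"
  proof (rule inj_onI)
    fix p q assume pq: "p \<in> Sigma (?I k) ext" "q \<in> Sigma (?I k) ext"
      and e: "(case p of (I, v) \<Rightarrow> (insert v I, v)) = (case q of (I, v) \<Rightarrow> (insert v I, v))"
    have "snd p \<notin> fst p" "snd q \<notin> fst q" using pq by (auto simp: ext_def)
    moreover have "snd p = snd q" "insert (snd p) (fst p) = insert (snd q) (fst q)"
      using e by (auto simp: case_prod_unfold)
    ultimately show "p = q" by (simp add: insert_ident prod_eq_iff)
  qed
  have "real (card (?I k)) * ?x \<le> (\<Sum>I\<in>?I k. real (card (ext I)))"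
    using sum_mono[OF ext, of "?I k" "\<lambda>x. x"] by simp
  also have "\<dots> = real (card (Sigma (?I k) ext))"
    using fI V by (subst card_SigmaI) (auto simp: ext_def)
  also have "\<dots> = real (card ((\<lambda>(I, v). (insert v I, v)) ` Sigma (?I k) ext))"
    by (simp add: card_image[OF inj])
  also have "\<dots> \<le> real (card (SIGMA J:?I (Suc k). J))"
  proof (intro of_nat_mono card_mono)
    show "finite (SIGMA J:?I (Suc k). J)"
      using fI V by (intro finite_SigmaI) (auto simp: indep_sets_def dest: finite_subset)
    show "(\<lambda>(I, v). (insert v I, v)) ` Sigma (?I k) ext \<subseteq> (SIGMA J:?I (Suc k). J)"
      using V sym by (fastforce simp: ext_def indep_sets_def pairwise_insert dest: finite_subset)
  qed
  also have "\<dots> = real (Suc k) * real (card (?I (Suc k)))"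
    using fI V
    by (subst card_SigmaI) (auto simp: indep_sets_def algebra_simps dest: finite_subset)
  finally have 1: "real (card (?I k)) * ?x \<le> real (Suc k) * real (card (?I (Suc k)))" .
  have "?x ^ Suc k \<le> fact k * real (card (?I k)) * ?x"
    using mult_right_mono[OF Suc.IH, of ?x] Suc.prems s by (simp add: mult.commute)
  also have "\<dots> \<le> fact k * (real (Suc k) * real (card (?I (Suc k))))"
    using mult_left_mono[OF 1, of "fact k"] by (simp add: mult.assoc)
  finally show ?case by (simp add: algebra_simps)
qed

section \<open>Binomial estimates\<close>

lemma gbinomial_ge_power:
  fixes x :: real
  assumes "real k \<le> x"
  shows "(x - real k) ^ k / fact k \<le> x gchoose k"
proof -
  have "(\<Prod>i = 0..<k. x - real k) \<le> (\<Prod>i = 0..<k. x - real i)"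
    using assms by (intro prod_mono) auto
  then show ?thesis by (simp add: gbinomial_prod_rev divide_right_mono)
qed

lemma gbinomial_le_power:
  fixes x :: real
  assumes "real k \<le> x"
  shows "x gchoose k \<le> x ^ k / fact k"
proof -
  have "(\<Prod>i = 0..<k. x - real i) \<le> (\<Prod>i = 0..<k. x)"
    using assms by (intro prod_mono) auto
  then show ?thesis by (simp add: gbinomial_prod_rev divide_right_mono)
qed

text \<open>From \<open>k - 1\<close> onwards all factors of the falling factorial are nonnegative
  and increasing, so the generalised binomial is strictly increasing there.\<close>

lemma gbinomial_le_cancel:
  fixes x y :: real
  assumes k: "k > 0" and y: "real k - 1 \<le> y" and le: "x gchoose k \<le> y gchoose k"
  shows "x \<le> y"
proof (rule ccontr)
  assume "\<not> x \<le> y"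
  then have "(\<Prod>i = 0..<k. y - real i) < (\<Prod>i = 0..<k. x - real i)"
    using k y by (intro prod_mono_strict[of 0]) auto
  then show False using le by (simp add: gbinomial_prod_rev divide_le_cancel)
qed

text \<open>Intermediate value theorem between \<open>k - 1\<close>, where the value is 0, and
  \<open>k (1 + N)\<close>, where it is at least \<open>(1 + N) ^ k\<close>.\<close>

lemma gbinomial_surj:
  fixes N :: real
  assumes k: "k > 0" and N: "N \<ge> 0"
  obtains x where "real k - 1 \<le> x" "x gchoose k = N"
proof -
  have "(real k - 1) gchoose k = real ((k - 1) choose k)"
    using k by (simp add: binomial_gbinomial of_nat_diff)
  also have "(k - 1) choose k = 0" using k by (simp add: binomial_eq_0)
  finally have lo: "(real k - 1) gchoose k \<le> N" using N by simp
  have "N \<le> (1 + N) ^ 1" by simp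
  also have "\<dots> \<le> (1 + N) ^ k" using k N by (intro power_increasing) auto
  also have "\<dots> = (real k * (1 + N) / real k) ^ k" using k by simp
  also have "\<dots> \<le> (real k * (1 + N)) gchoose k"
    using N by (intro gbinomial_ge_n_over_k_pow_k) (simp add: algebra_simps)
  finally have hi: "N \<le> (real k * (1 + N)) gchoose k" .
  have le: "real k - 1 \<le> real k * (1 + N)" using N by (simp add: algebra_simps add_increasing2)
  have "continuous_on {real k - 1..real k * (1 + N)} (\<lambda>x. x gchoose k)"
    unfolding gbinomial_prod_rev by (intro continuous_intros) auto
  from IVT'[OF lo hi le this] show ?thesis using that by auto
qed

text \<open>The upper half of a weak Stirling formula. The induction step amounts to
  \<open>(1 - 1 / (k + 1)) ^ (k + 1) \<le> 1 / e\<close>.\<close>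

lemma fact_le_exp_power:
  "k \<ge> 1 \<Longrightarrow> fact k * exp (real k) \<le> exp 1 * real k * real k ^ k"
proof (induction k rule: nat_induct_at_least)
  case base
  then show ?case by simp
next
  case (Suc k)
  have k: "real k > 0" using Suc by simp
  have e: "exp 1 * real k ^ Suc k \<le> real (Suc k) ^ Suc k"
  proof -
    have "exp (- 1 / real (Suc k)) \<ge> 1 + (- 1 / real (Suc k))" by (rule exp_ge_add_one_self)
    also have "1 + (- 1 / real (Suc k)) = real k / real (Suc k)" using k by (simp add: field_simps)
    finally have "(real k / real (Suc k)) ^ Suc k \<le> exp (- 1 / real (Suc k)) ^ Suc k"
      by (intro power_mono) auto
    also have "\<dots> = exp (real (Suc k) * (- 1 / real (Suc k)))" by (rule exp_of_nat_mult[symmetric])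
    also have "\<dots> = 1 / exp 1" by (simp add: exp_minus inverse_eq_divide del: of_nat_Suc)
    finally show ?thesis
      by (simp add: power_divide divide_le_eq le_divide_eq mult.commute del: power_Suc of_nat_Suc)
  qed
  have "fact (Suc k) * exp (real (Suc k)) = real (Suc k) * exp 1 * (fact k * exp (real k))"
    by (simp add: exp_add algebra_simps)
  also have "\<dots> \<le> real (Suc k) * exp 1 * (exp 1 * real k * real k ^ k)"
    using Suc.IH by (intro mult_left_mono) auto
  also have "\<dots> = exp 1 * real (Suc k) * (exp 1 * real k ^ Suc k)" by simp
  also have "\<dots> \<le> exp 1 * real (Suc k) * real (Suc k) ^ Suc k"
    using e by (intro mult_left_mono) auto
  finally show ?case .
qed

section \<open>Central and near-central binomial coefficients\<close>

lemma two_power_le_central_binom: "2 ^ n \<le> (n + 1) * central_binom n"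
proof -
  have "2 ^ n = (\<Sum>k\<le>n. n choose k)" by (simp add: choose_row_sum)
  also have "\<dots> \<le> (\<Sum>k\<le>n. central_binom n)"
    unfolding central_binom_def by (intro sum_mono binomial_maximum)
  finally show ?thesis by simp
qed

text \<open>Shows that \<open>m\<close> outgrows every fixed power of \<open>n\<close>; the case
  \<open>k = t + 1\<close> forces \<open>s\<close> to tend to infinity.\<close>

lemma central_binom_ge_power:
  assumes "k \<le> n"
  shows "(real n / real k) ^ k \<le> real (central_binom n)"
proof -
  have "(real n / real k) ^ k \<le> real (n choose k)" by (rule binomial_ge_n_over_k_pow_k[OF assms])
  also have "\<dots> \<le> real (central_binom n)" unfolding central_binom_def by (simp add: binomial_maximum)
  finally show ?thesis .
qed

text \<open>Induction on the offset: the ratio of consecutive coefficients near the middle tends to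
  1. The sandwich only removes the rounding in \<open>n div 2\<close>.\<close>

lemma near_central_binom:
  "(\<lambda>n. real (n choose (n div 2 + i)) / real (central_binom n)) \<longlonglongrightarrow> 1"
proof (induction i)
  case 0
  have "real (n choose (n div 2 + 0)) / real (central_binom n) = 1" for n
    by (simp add: central_binom_def not_less)
  then show ?case by (simp only: tendsto_const)
next
  case (Suc i)
  have "(\<lambda>n. (real n - real (n div 2) - real i) / (real (n div 2) + real i + 1)) \<longlonglongrightarrow> 1"
  proof (rule tendsto_sandwich)
    show "\<forall>\<^sub>F n in sequentially. (real n / 2 - real i) / (real n / 2 + real i + 1)
        \<le> (real n - real (n div 2) - real i) / (real (n div 2) + real i + 1)"
      using eventually_ge_at_top[of "2 * i"]
    proof eventually_elim
      case (elim n)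
      then show ?case by (intro frac_le) linarith+
    qed
    show "\<forall>\<^sub>F n in sequentially. (real n - real (n div 2) - real i) / (real (n div 2) + real i + 1)
        \<le> (real n / 2 + 1 - real i) / (real n / 2 + real i)"
      using eventually_ge_at_top[of "2 * i + 2"]
    proof eventually_elim
      case (elim n)
      then show ?case by (intro frac_le) linarith+
    qed
  qed real_asymp+
  from tendsto_mult[OF Suc this] have
    "(\<lambda>n. real (n choose (n div 2 + i)) / real (central_binom n) *
      ((real n - real (n div 2) - real i) / (real (n div 2) + real i + 1))) \<longlonglongrightarrow> 1" by simp
  then show ?case
  proof (rule Lim_transform_eventually)
    show "\<forall>\<^sub>F n in sequentially. real (n choose (n div 2 + i)) / real (central_binom n) *
      ((real n - real (n div 2) - real i) / (real (n div 2) + real i + 1))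
      = real (n choose (n div 2 + Suc i)) / real (central_binom n)"
      using eventually_ge_at_top[of "2 * i + 2"]
    proof eventually_elim
      case (elim n)
      let ?k = "n div 2 + i"
      have k: "?k \<le> n" using elim by linarith
      have "Suc ?k * (n choose Suc ?k) = (n - ?k) * (n choose ?k)"
        using binomial_absorb_comp[of n ?k] Suc_times_binomial_eq[of "n - 1" ?k] elim by simp
      then have "real (Suc ?k) * real (n choose Suc ?k) = real (n - ?k) * real (n choose ?k)"
        by (metis of_nat_mult)
      then have "real (n choose Suc ?k)
          = (real n - real (n div 2) - real i) * real (n choose ?k) / (real (n div 2) + real i + 1)"
        using k by (simp add: of_nat_diff field_simps)
      then show ?case by (simp add: mult.commute)
    qed
  qed
qed

section \<open>Counting antichains\<close>

text \<open>Strict inclusions make a set incomparable to itself; \<open>pairwise\<close> tests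
  distinct members only, so its cliques are exactly the antichains.\<close>

definition incomparable :: "'a set \<Rightarrow> 'a set \<Rightarrow> bool" where
  "incomparable A B \<longleftrightarrow> \<not> A \<subset> B \<and> \<not> B \<subset> A"

lemma num_antichains_eq_indep_sets:
  "num_antichains n s = card {I \<in> indep_sets incomparable (Pow {1..n}). card I = s}"
proof -
  have "{\<A>. \<A> \<subseteq> Pow {1..n} \<and> antichain \<A> \<and> card \<A> = s}
      = {I \<in> indep_sets incomparable (Pow {1..n}). card I = s}"
    by (auto simp: antichain_def indep_sets_def pairwise_def incomparable_def)
  then show ?thesis by (simp add: num_antichains_def)
qed

text \<open>Within \<open>t\<close> consecutive layers, comparable sets differ in fewer than
  \<open>t\<close> elements. Symmetric difference with \<open>A\<close> is injective, so the small
  subsets of \<open>{1..n}\<close> bound the count.\<close>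

lemma comparable_degree_le:
  assumes V: "\<And>A. A \<in> V \<Longrightarrow> A \<subseteq> {1..n} \<and> h \<le> card A \<and> card A < h + t"
    and A: "A \<in> V" and t: "t \<ge> 1" and n: "t \<le> n"
  shows "card {B \<in> V. B = A \<or> \<not> incomparable A B} \<le> t * n ^ (t - 1)"
proof -
  let ?T = "{X. X \<subseteq> {1..n} \<and> card X < t}" and ?f = "\<lambda>B. (A - B) \<union> (B - A)"
  have "?f B \<in> ?T" if B: "B \<in> {B \<in> V. B = A \<or> \<not> incomparable A B}" for B
  proof -
    have fin: "finite A" "finite B" using V[of A] V[of B] A B by (auto dest: finite_subset)
    from B consider "B = A" | "A \<subset> B" | "B \<subset> A" by (auto simp: incomparable_def)
    then have "card (?f B) < t"
    proof cases
      case 2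
      then have "?f B = B - A" by auto
      then show ?thesis using 2 V[of A] V[of B] A B fin by (simp add: card_Diff_subset) linarith
    next
      case 3
      then have "?f B = A - B" by auto
      then show ?thesis using 3 V[of A] V[of B] A B fin by (simp add: card_Diff_subset) linarith
    qed (use t in simp)
    then show ?thesis using V[of A] V[of B] A B by auto
  qed
  then have "card {B \<in> V. B = A \<or> \<not> incomparable A B} \<le> card ?T"
    by (intro card_inj_on_le[of ?f]) (auto simp: inj_on_def)
  also have "\<dots> = (\<Sum>k<t. n choose k)" by (simp add: card_subsets_less)
  also have "\<dots> \<le> (\<Sum>k<t. n ^ (t - 1))"
  proof (rule sum_mono)
    fix k assume k: "k \<in> {..<t}"
    then have "n choose k \<le> n ^ k" using n by (intro binomial_le_pow) auto
    also have "\<dots> \<le> n ^ (t - 1)" using k n t by (intro power_increasing) auto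
    finally show "n choose k \<le> n ^ (t - 1)" .
  qed
  finally show ?thesis by simp
qed

text \<open>The greedy count, applied to the \<open>t\<close> layers from \<open>n div 2\<close>
  upwards.\<close>

lemma num_antichains_ge:
  assumes t: "t \<ge> 1" "t \<le> n" and s: "s * (t * n ^ (t - 1)) \<le> (\<Sum>i<t. n choose (n div 2 + i))"
  shows "((\<Sum>i<t. real (n choose (n div 2 + i))) - real s * (real t * real n ^ (t - 1))) ^ s / fact s
    \<le> real (num_antichains n s)"
proof -
  let ?V = "{A. A \<subseteq> {1..n} \<and> n div 2 \<le> card A \<and> card A < n div 2 + t}"
  have V: "finite ?V" by (rule finite_subset[of _ "Pow {1..n}"]) auto
  have "?V = (\<Union>i<t. {A. A \<subseteq> {1..n} \<and> card A = n div 2 + i})"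
    by (auto simp: le_iff_add)
  also have "card \<dots> = (\<Sum>i<t. card {A. A \<subseteq> {1..n} \<and> card A = n div 2 + i})"
    by (intro card_UN_disjoint) auto
  also have "\<dots> = (\<Sum>i<t. n choose (n div 2 + i))" by (simp add: n_subsets)
  finally have cV: "card ?V = (\<Sum>i<t. n choose (n div 2 + i))" .
  have "(real (card ?V) - real s * real (t * n ^ (t - 1))) ^ s
      \<le> fact s * real (card {I \<in> indep_sets incomparable ?V. card I = s})"
  proof (rule count_indep_sets_ge[OF V])
    show "incomparable v u" if "incomparable u v" for u v :: "nat set"
      using that by (simp add: incomparable_def)
    show "real (card {u \<in> ?V. u = v \<or> \<not> incomparable v u}) \<le> real (t * n ^ (t - 1))"
      if "v \<in> ?V" for v
      by (intro of_nat_mono comparable_degree_le[where h = "n div 2"]) (use that t in auto)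
    show "real s * real (t * n ^ (t - 1)) \<le> real (card ?V)"
      using of_nat_mono[OF s, where 'a = real] unfolding cV by simp
  qed simp_all
  also have "\<dots> \<le> fact s * real (num_antichains n s)"
    unfolding num_antichains_eq_indep_sets
    by (intro mult_left_mono of_nat_mono card_mono) (auto simp: indep_sets_def)
  finally show ?thesis unfolding cV by (simp add: divide_le_eq mult.commute)
qed

text \<open>Index 1 belongs to the phase of large families, down to \<open>M1\<close> sets, and
  index 2 to the next one, down to \<open>M2\<close>. The phases are assembled from the innermost
  outwards, each bound serving as base case for the next.\<close>

lemma num_antichains_le:
  fixes \<mu> y1 y2 d1 d2 M1 M2 :: real
  assumes deg1: "\<And>F. F \<subseteq> Pow {1..n} \<Longrightarrow> M1 \<le> real (card F) \<Longrightarrow>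
      \<exists>B\<in>F. d1 \<le> real (card {A \<in> F. A \<subset> B})"
    and deg2: "\<And>F. F \<subseteq> Pow {1..n} \<Longrightarrow> M2 \<le> real (card F) \<Longrightarrow>
      \<exists>B\<in>F. d2 \<le> real (card {A \<in> F. A \<subset> B})"
    and \<mu>: "0 \<le> \<mu>" "\<mu> \<le> y1 * exp (y1 * d1)" "\<mu> \<le> y2 * exp (y2 * d2)"
    and y: "0 \<le> y1" "0 \<le> y2"
  shows "real (num_antichains n s) * \<mu> ^ s \<le> exp (\<mu> * M2 + y2 * M1 + y1 * 2 ^ n)"
proof -
  let ?V = "Pow {1..n}" and ?Z = "indep_poly incomparable \<mu>"
  have deg: "\<exists>v\<in>U. d \<le> real (card {u \<in> U - {v}. \<not> incomparable v u})"
    if U: "U \<subseteq> ?V" and ex: "\<exists>B\<in>U. d \<le> real (card {A \<in> U. A \<subset> B})" for U and d :: real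
  proof -
    obtain B where B: "B \<in> U" "d \<le> real (card {A \<in> U. A \<subset> B})" using ex by blast
    have "finite U" using U by (rule finite_subset) simp
    then have "card {A \<in> U. A \<subset> B} \<le> card {u \<in> U - {B}. \<not> incomparable B u}"
      by (intro card_mono) (auto simp: incomparable_def)
    then show ?thesis using B by force
  qed
  have 0: "?Z U \<le> exp (\<mu> * M2)" if "U \<subseteq> ?V" "real (card U) \<le> M2" for U
  proof -
    have "finite U" using that(1) by (rule finite_subset) simp
    then have "?Z U \<le> exp (\<mu> * real (card U))" using \<mu>(1) by (rule indep_poly_le_exp_card)
    also have "\<dots> \<le> exp (\<mu> * M2)" using that(2) \<mu>(1) by (simp add: mult_left_mono)
    finally show ?thesis .
  qed
  have 1: "?Z U \<le> exp (\<mu> * M2 + y2 * M1)" if U: "U \<subseteq> ?V" "real (card U) \<le> M1" for U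
  proof -
    have "?Z U \<le> exp (\<mu> * M2) * exp (y2 * real (card U))"
      by (rule indep_poly_le_exp[where V = ?V and d = d2 and M = M2])
        (use \<mu> y U 0 deg deg2 in auto)
    also have "\<dots> \<le> exp (\<mu> * M2) * exp (y2 * M1)" using U y by (simp add: mult_left_mono)
    finally show ?thesis by (simp add: exp_add)
  qed
  have "?Z ?V \<le> exp (\<mu> * M2 + y2 * M1) * exp (y1 * real (card ?V))"
    by (rule indep_poly_le_exp[where V = ?V and d = d1 and M = M1])
      (use \<mu> y 1 deg deg1 in auto)
  moreover have "real (num_antichains n s) * \<mu> ^ s \<le> ?Z ?V"
    unfolding num_antichains_eq_indep_sets using \<mu>(1) by (intro count_indep_sets_le) auto
  ultimately show ?thesis by (simp add: exp_add card_Pow)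
qed

section \<open>Asymptotics for a fixed sequence \<open>s\<close>\<close>

context
  fixes t :: nat and s :: "nat \<Rightarrow> nat"
  assumes t: "t \<ge> 1"
    and s: "\<And>n. n \<ge> 1 \<Longrightarrow> s n > 0"
    and s_large: "much_less (\<lambda>n. real (central_binom n) / real n ^ t) (\<lambda>n. real (s n))"
    and s_small: "much_less (\<lambda>n. real (s n)) (\<lambda>n. real (central_binom n) / real n ^ (t - 1))"
begin

text \<open>The ratio of \<open>s\<close> to its lower threshold \<open>m / n ^ t\<close>. It tends
  to infinity, and the second phase costs \<open>O(ln x / x)\<close> times \<open>s\<close> at
  density \<open>x\<close>.\<close>

definition density :: "nat \<Rightarrow> real" where
  "density n = real (s n) * real n ^ t / real (central_binom n)"

lemma density_at_top: "filterlim density at_top sequentially"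
proof -
  have "(\<lambda>n. real (central_binom n) / real n ^ t / real (s n)) \<longlonglongrightarrow> 0"
    using s_large by (simp add: much_less_def)
  moreover have "\<forall>\<^sub>F n in sequentially. 0 < real (central_binom n) / real n ^ t / real (s n)"
    using eventually_ge_at_top[of 1] by eventually_elim (use s in simp)
  ultimately have "filterlim (\<lambda>n. inverse (real (central_binom n) / real n ^ t / real (s n)))
      at_top sequentially"
    by (rule filterlim_inverse_at_top)
  then show ?thesis
    by (rule filterlim_mono_eventually) (auto simp: density_def field_simps)
qed

lemma s_times_power_tendsto: "(\<lambda>n. real (s n) * real n ^ (t - 1) / real (central_binom n)) \<longlonglongrightarrow> 0"
  using s_small by (simp add: much_less_def)

lemma s_over_central_tendsto: "(\<lambda>n. real (s n) / real (central_binom n)) \<longlonglongrightarrow> 0"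
proof (rule tendsto_sandwich[OF _ _ tendsto_const s_times_power_tendsto])
  show "\<forall>\<^sub>F n in sequentially. real (s n) / real (central_binom n)
      \<le> real (s n) * real n ^ (t - 1) / real (central_binom n)"
    using eventually_ge_at_top[of 1]
  proof eventually_elim
    case (elim n)
    then have "1 \<le> real n ^ (t - 1)" by (intro one_le_power) simp
    then have "real (s n) * 1 \<le> real (s n) * real n ^ (t - 1)" by (intro mult_left_mono) auto
    then show ?case by (simp add: divide_right_mono)
  qed
qed simp

text \<open>Eventually \<open>s \<ge> m / n ^ t\<close>, while \<open>m\<close> is at least of order
  \<open>n ^ (t + 1)\<close>.\<close>

lemma s_at_top: "filterlim (\<lambda>n. real (s n)) at_top sequentially"
proof (rule filterlim_at_top_mono)
  show "filterlim (\<lambda>n. real n * (1 / real (t + 1) ^ (t + 1))) at_top sequentially"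
    by (intro filterlim_at_top_mult_tendsto_pos[OF tendsto_const] filterlim_real_sequentially) simp
  show "\<forall>\<^sub>F n in sequentially. real n * (1 / real (t + 1) ^ (t + 1)) \<le> real (s n)"
    using eventually_ge_at_top[of "t + 1"] filterlim_at_top[THEN iffD1, OF density_at_top, rule_format, of 1]
  proof eventually_elim
    case (elim n)
    have n: "real n ^ t > 0" using elim(1) by simp
    have "real n * (1 / real (t + 1) ^ (t + 1)) * real n ^ t = (real n / real (t + 1)) ^ (t + 1)"
      by (simp add: power_divide)
    also have "\<dots> \<le> real (central_binom n)" using elim(1) by (intro central_binom_ge_power)
    also have "\<dots> \<le> real (s n) * real n ^ t"
      using elim(2) by (simp add: density_def le_divide_eq)
    finally show ?case using n by (subst (asm) mult_le_cancel_right_pos) auto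
  qed
qed

lemma eventually_s_le:
  assumes "\<eta> > 0"
  shows "\<forall>\<^sub>F n in sequentially. real (s n) \<le> \<eta> * real (central_binom n)"
  using order_tendstoD(2)[OF s_over_central_tendsto assms]
  by eventually_elim (simp add: divide_less_eq less_imp_le)

text \<open>The \<open>t\<close> layers have \<open>(t + o(1)) m\<close> members and the greedy loss
  \<open>s t n ^ (t - 1)\<close> is \<open>o(m)\<close>, so the base of the power eventually exceeds
  \<open>(t - \<delta>) m\<close>.\<close>

lemma eventually_num_antichains_ge:
  assumes \<delta>: "0 < \<delta>" "\<delta> \<le> real t"
  shows "\<forall>\<^sub>F n in sequentially. ((real t - \<delta>) * real (central_binom n)) gchoose s n
      \<le> real (num_antichains n (s n))"
proof (cases "\<delta> = real t")
  \<comment> \<open>The upper argument is then 0 and \<open>s n > 0\<close>, so the binomial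
    vanishes.\<close>
  case True
  show ?thesis using eventually_ge_at_top[of 1]
  proof eventually_elim
    case (elim n)
    then have "(0 :: real) gchoose s n = 0" using s[of n] by (cases "s n") auto
    then show ?case using True by simp
  qed
next
  case False
  have "(\<lambda>n. \<Sum>i<t. real (n choose (n div 2 + i)) / real (central_binom n)) \<longlonglongrightarrow> (\<Sum>i<t. 1)"
    by (intro tendsto_sum near_central_binom)
  then have lim: "(\<lambda>n. (\<Sum>i<t. real (n choose (n div 2 + i)) / real (central_binom n))
      - real t * (real (s n) * real n ^ (t - 1) / real (central_binom n))) \<longlonglongrightarrow> real t - real t * 0"
    by (intro tendsto_diff tendsto_mult tendsto_const s_times_power_tendsto) simp
  have "\<forall>\<^sub>F n in sequentially. real (s n) \<le> (real t - \<delta>) * real (central_binom n)"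
    using False \<delta> by (intro eventually_s_le) simp
  moreover have "\<forall>\<^sub>F n in sequentially. real t - \<delta> <
      (\<Sum>i<t. real (n choose (n div 2 + i)) / real (central_binom n))
      - real t * (real (s n) * real n ^ (t - 1) / real (central_binom n))"
    using order_tendstoD(1)[OF lim, of "real t - \<delta>"] \<delta> by simp
  ultimately show ?thesis using eventually_ge_at_top[of t]
  proof eventually_elim
    case (elim n)
    let ?m = "real (central_binom n)" and ?S = "\<Sum>i<t. real (n choose (n div 2 + i))"
    have "(real t - \<delta>) < (?S - real (s n) * (real t * real n ^ (t - 1))) / ?m"
      using elim(2) by (simp add: sum_divide_distrib[symmetric] diff_divide_distrib mult_ac)
    then have le: "(real t - \<delta>) * ?m \<le> ?S - real (s n) * (real t * real n ^ (t - 1))"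
      by (simp add: less_divide_eq)
    have x0: "0 \<le> (real t - \<delta>) * ?m" using \<delta> by simp
    have "real (s n * (t * n ^ (t - 1))) \<le> real (\<Sum>i<t. n choose (n div 2 + i))"
      using le x0 by simp
    then have "s n * (t * n ^ (t - 1)) \<le> (\<Sum>i<t. n choose (n div 2 + i))" by (simp only: of_nat_le_iff)
    note ge = num_antichains_ge[OF t elim(3) this]
    have "((real t - \<delta>) * ?m) gchoose s n \<le> ((real t - \<delta>) * ?m) ^ s n / fact (s n)"
      using elim(1) by (rule gbinomial_le_power)
    also have "\<dots> \<le> (?S - real (s n) * (real t * real n ^ (t - 1))) ^ s n / fact (s n)"
      using le x0 by (intro divide_right_mono power_mono) auto
    finally show ?case using ge by linarith
  qed
qed

text \<open>The slack \<open>\<delta>\<close> is spent in three portions: up to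
  \<open>\<delta> / 4\<close> on supersaturation, up to \<open>\<delta> / 2\<close> on three error
  factors \<open>exp (\<kappa> s)\<close>, and the rest on passing from a power to a falling
  factorial.\<close>

lemma eventually_num_antichains_le:
  assumes \<delta>: "0 < \<delta>"
  shows "\<forall>\<^sub>F n in sequentially. real (num_antichains n (s n))
      \<le> ((real t + \<delta>) * real (central_binom n)) gchoose s n"
proof -
  define \<epsilon> where "\<epsilon> = \<delta> / 4"
  define \<kappa> where "\<kappa> = ln ((real t + \<delta> / 2) / (real t + \<epsilon>)) / 3"
  have \<epsilon>: "\<epsilon> > 0" using \<delta> by (simp add: \<epsilon>_def)
  have te: "real t + \<epsilon> \<ge> 1" using t \<epsilon> by linarith
  have \<kappa>: "\<kappa> > 0" using \<delta> te by (simp add: \<kappa>_def \<epsilon>_def)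
  have exp\<kappa>: "(real t + \<epsilon>) * exp (3 * \<kappa>) = real t + \<delta> / 2"
    using \<delta> te by (simp add: \<kappa>_def)
  \<comment> \<open>Degrees of order \<open>n ^ (t + 2)\<close> are needed because this phase starts
    from all \<open>2 ^ n \<le> (n + 1) m\<close> sets: the two extra powers of \<open>n\<close>
    beat \<open>(n + 1) ln n\<close>.\<close>
  obtain c1 where c1: "c1 > 0" "\<forall>\<^sub>F n in sequentially. \<forall>F. F \<subseteq> Pow {1..n} \<longrightarrow>
       (real (t + 2) + 1) * real (central_binom n) \<le> real (card F) \<longrightarrow>
       (\<exists>B\<in>F. c1 * real n ^ (t + 2) \<le> real (card {A \<in> F. A \<subset> B}))"
    using large_family_has_large_degree[of "t + 2" 1] by auto
  obtain c2 where c2: "c2 > 0" "\<forall>\<^sub>F n in sequentially. \<forall>F. F \<subseteq> Pow {1..n} \<longrightarrow>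
       (real t + \<epsilon>) * real (central_binom n) \<le> real (card F) \<longrightarrow>
       (\<exists>B\<in>F. c2 * real n ^ t \<le> real (card {A \<in> F. A \<subset> B}))"
    using large_family_has_large_degree[OF t \<epsilon>] by auto
  have ev_y1: "\<forall>\<^sub>F n in sequentially. 1 \<le> real (t + 2) * ln (real n) / c1"
  proof -
    have "filterlim (\<lambda>n. real (t + 2) * ln (real n) / c1) at_top sequentially"
      using c1(1) by real_asymp
    then show ?thesis by (simp add: filterlim_at_top)
  qed
  have ev_y2: "\<forall>\<^sub>F n in sequentially. 1 \<le> ln (density n) / c2"
  proof -
    have "filterlim (\<lambda>x. ln x / c2) at_top at_top" using c2(1) by real_asymp
    from filterlim_compose[OF this density_at_top] show ?thesis by (simp add: filterlim_at_top)
  qed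
  have ev_e1: "\<forall>\<^sub>F n in sequentially.
      real (t + 2) / c1 * (ln (real n) * (real n + 1) / real n ^ 2) < \<kappa>"
  proof -
    have "(\<lambda>n. ln (real n) * (real n + 1) / real n ^ 2) \<longlonglongrightarrow> 0" by real_asymp
    from tendsto_mult_right_zero[OF this, of "real (t + 2) / c1"] show ?thesis
      using \<kappa> by (rule order_tendstoD(2))
  qed
  have ev_e2: "\<forall>\<^sub>F n in sequentially. (real t + 3) / c2 * (ln (density n) / density n) < \<kappa>"
  proof -
    have "((\<lambda>x :: real. ln x / x) \<longlongrightarrow> 0) at_top" by real_asymp
    from filterlim_compose[OF this density_at_top]
    have "(\<lambda>n. ln (density n) / density n) \<longlonglongrightarrow> 0" .
    from tendsto_mult_right_zero[OF this, of "(real t + 3) / c2"] show ?thesis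
      using \<kappa> by (rule order_tendstoD(2))
  qed
  have ev_e3: "\<forall>\<^sub>F n in sequentially. exp 1 * real (s n) < exp (\<kappa> * real (s n))"
  proof -
    have "\<forall>\<^sub>F x in at_top. exp 1 * x < exp (\<kappa> * x)" using \<kappa> by real_asymp
    from eventually_compose_filterlim[OF this s_at_top] show ?thesis .
  qed
  have ev_L: "\<forall>\<^sub>F n in sequentially. 1 \<le> density n"
    using density_at_top by (simp add: filterlim_at_top)
  have ev_s: "\<forall>\<^sub>F n in sequentially. real (s n) \<le> \<delta> / 2 * real (central_binom n)"
    and ev_1: "\<forall>\<^sub>F n in sequentially. real (s n) \<le> 1 * real (central_binom n)"
    using \<delta> by (intro eventually_s_le; simp)+
  show ?thesis
    using c1(2) c2(2) ev_y1 ev_y2 ev_e1 ev_e2 ev_e3 ev_L ev_s ev_1 eventually_ge_at_top[of 1]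
  proof eventually_elim
    case (elim n)
    let ?m = "real (central_binom n)" and ?s = "real (s n)" and ?N = "real (num_antichains n (s n))"
    let ?L = "density n"
    \<comment> \<open>This minimises \<open>exp (\<mu> M) / \<mu> ^ s\<close> for
      \<open>M = (t + \<epsilon>) m\<close>, and makes the exponent of the last phase exactly
      \<open>s\<close>.\<close>
    define \<mu> where "\<mu> = ?s / ((real t + \<epsilon>) * ?m)"
    \<comment> \<open>chosen so that \<open>exp (y1 d1) = n ^ (t + 2)\<close> and \<open>exp (y2 d2) = density n\<close>\<close>
    define y1 where "y1 = real (t + 2) * ln (real n) / (c1 * real n ^ (t + 2))"
    define y2 where "y2 = ln ?L / (c2 * real n ^ t)"
    have n0: "real n > 0" and s0: "?s > 0" and L0: "?L > 0"
      using elim(11) s[of n] elim(8) by auto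
    have \<mu>0: "\<mu> > 0" using s0 te by (simp add: \<mu>_def)
    have \<mu>_le: "\<mu> \<le> ?s / ?m"
      using te s0 by (auto simp: \<mu>_def intro!: divide_left_mono mult_pos_pos)
    have mL: "?s / ?m = ?L / real n ^ t" using n0 by (simp add: density_def)
    have sL: "?s = ?L * ?m / real n ^ t" using mL by (simp add: divide_eq_eq)
    have y1: "y1 * (c1 * real n ^ (t + 2)) = real (t + 2) * ln (real n)"
      using n0 c1(1) by (simp add: y1_def)
    have y2: "y2 * (c2 * real n ^ t) = ln ?L"
      using n0 c2(1) by (simp add: y2_def)
    have "?N * \<mu> ^ s n \<le> exp (\<mu> * ((real t + \<epsilon>) * ?m) + y2 * ((real (t + 2) + 1) * ?m) + y1 * 2 ^ n)"
    proof (rule num_antichains_le)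
      show "\<exists>B\<in>F. c1 * real n ^ (t + 2) \<le> real (card {A \<in> F. A \<subset> B})"
        if "F \<subseteq> Pow {1..n}" "(real (t + 2) + 1) * ?m \<le> real (card F)" for F
        using elim(1) that by blast
      show "\<exists>B\<in>F. c2 * real n ^ t \<le> real (card {A \<in> F. A \<subset> B})"
        if "F \<subseteq> Pow {1..n}" "(real t + \<epsilon>) * ?m \<le> real (card F)" for F
        using elim(2) that by blast
      show "\<mu> \<le> y1 * exp (y1 * (c1 * real n ^ (t + 2)))"
      proof -
        have "exp (y1 * (c1 * real n ^ (t + 2))) = real n ^ (t + 2)"
          unfolding y1 exp_of_nat_mult using n0 by simp
        then have "y1 * exp (y1 * (c1 * real n ^ (t + 2))) = real (t + 2) * ln (real n) / c1"
          using n0 by (simp add: y1_def)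
        moreover have "?s / ?m \<le> 1" using elim(10) by (simp add: divide_le_eq)
        ultimately show ?thesis using \<mu>_le elim(3) by linarith
      qed
      show "\<mu> \<le> y2 * exp (y2 * (c2 * real n ^ t))"
      proof -
        have "\<mu> \<le> ?L / real n ^ t * 1" using \<mu>_le mL by simp
        also have "\<dots> \<le> ?L / real n ^ t * (ln ?L / c2)"
          using elim(4) L0 by (intro mult_left_mono) auto
        also have "\<dots> = y2 * exp (y2 * (c2 * real n ^ t))"
          unfolding y2 using L0 by (simp add: y2_def mult.commute)
        finally show ?thesis .
      qed
      show "0 \<le> y1" "0 \<le> y2"
        using c1(1) c2(1) elim(8,11) by (auto simp: y1_def y2_def)
    qed (use \<mu>0 in simp)
    also have "\<dots> \<le> exp (?s + \<kappa> * ?s + \<kappa> * ?s)"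
    proof -
      have "\<mu> * ((real t + \<epsilon>) * ?m) = ?s" using te by (simp add: \<mu>_def)
      moreover have "y2 * ((real (t + 2) + 1) * ?m) \<le> \<kappa> * ?s"
      proof -
        have "y2 * ((real (t + 2) + 1) * ?m) = (real t + 3) / c2 * (ln ?L / ?L) * ?s"
          unfolding sL using L0 by (simp add: y2_def mult_ac)
        then show ?thesis using mult_right_mono[OF less_imp_le[OF elim(6)], of ?s] by simp
      qed
      moreover have "y1 * 2 ^ n \<le> \<kappa> * ?s"
      proof -
        have "?m / real n ^ t \<le> ?s"
          using elim(8) n0 by (simp add: density_def divide_le_eq le_divide_eq)
        moreover have "real (2 ^ n) \<le> real ((n + 1) * central_binom n)"
          using two_power_le_central_binom by (rule of_nat_mono)
        then have "y1 * 2 ^ n \<le> y1 * ((real n + 1) * ?m)"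
          using c1(1) elim(11) by (intro mult_left_mono) (auto simp: y1_def algebra_simps)
        moreover have "y1 * ((real n + 1) * ?m)
            = real (t + 2) / c1 * (ln (real n) * (real n + 1) / real n ^ 2) * (?m / real n ^ t)"
          unfolding y1_def power_add[of "real n" t 2] by (simp add: mult_ac)
        moreover have "\<dots> \<le> \<kappa> * (?m / real n ^ t)"
          using elim(5) by (intro mult_right_mono) auto
        moreover have "\<dots> \<le> \<kappa> * ?s" using \<kappa> calculation(1) by (intro mult_left_mono) auto
        ultimately show ?thesis by linarith
      qed
      ultimately show ?thesis by simp
    qed
    finally have "?N \<le> exp (?s + \<kappa> * ?s + \<kappa> * ?s) / \<mu> ^ s n"
      using \<mu>0 by (simp add: le_divide_eq)
    also have "\<dots> = (exp ?s / ?s ^ s n) * (exp (2 * \<kappa> * ?s) * ((real t + \<epsilon>) * ?m) ^ s n)"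
    proof -
      have "exp (?s + \<kappa> * ?s + \<kappa> * ?s) = exp ?s * exp (2 * \<kappa> * ?s)"
        unfolding exp_add[symmetric] by (simp add: algebra_simps)
      then show ?thesis by (simp add: \<mu>_def power_divide)
    qed
    \<comment> \<open>The third error factor: it absorbs the loss \<open>e s\<close> in the Stirling
      bound.\<close>
    also have "\<dots> \<le> (exp (\<kappa> * ?s) / fact (s n)) * (exp (2 * \<kappa> * ?s) * ((real t + \<epsilon>) * ?m) ^ s n)"
    proof (rule mult_right_mono)
      have "fact (s n) * exp ?s \<le> exp 1 * ?s * ?s ^ s n"
        using s0 by (intro fact_le_exp_power) simp
      also have "\<dots> \<le> exp (\<kappa> * ?s) * ?s ^ s n"
        using elim(7) by (intro mult_right_mono) auto
      finally show "exp ?s / ?s ^ s n \<le> exp (\<kappa> * ?s) / fact (s n)"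
        using s0 by (simp add: field_simps)
    qed (use te in simp)
    also have "\<dots> = exp (?s * (3 * \<kappa>)) * ((real t + \<epsilon>) * ?m) ^ s n / fact (s n)"
    proof -
      have "exp (?s * (3 * \<kappa>)) = exp (\<kappa> * ?s) * exp (2 * \<kappa> * ?s)"
        unfolding exp_add[symmetric] by (simp add: algebra_simps)
      then show ?thesis by simp
    qed
    also have "\<dots> = ((real t + \<epsilon>) * exp (3 * \<kappa>) * ?m) ^ s n / fact (s n)"
      unfolding exp_of_nat_mult by (simp add: power_mult_distrib)
    also have "\<dots> = ((real t + \<delta> / 2) * ?m) ^ s n / fact (s n)" unfolding exp\<kappa> ..
    \<comment> \<open>Eventually \<open>s \<le> (\<delta> / 2) m\<close>, so even the smallest
      factor of the falling factorial exceeds \<open>(t + \<delta> / 2) m\<close>.\<close>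
    also have "\<dots> \<le> ((real t + \<delta>) * ?m - ?s) ^ s n / fact (s n)"
      using elim(9) \<delta> by (intro divide_right_mono power_mono) (auto simp: algebra_simps)
    also have "\<dots> \<le> ((real t + \<delta>) * ?m) gchoose s n"
    proof (rule gbinomial_ge_power)
      have "1 * ?m \<le> (real t + \<delta>) * ?m" using t \<delta> by (intro mult_right_mono) auto
      then show "?s \<le> (real t + \<delta>) * ?m" using elim(10) by linarith
    qed
    finally show ?case .
  qed
qed

text \<open>On the increasing branch, where \<open>x n\<close> lies, both bounds on the number of
  antichains can be inverted to bounds on \<open>x n\<close>.\<close>

lemma gbinomial_parameter_tendsto:
  assumes x: "\<And>n. n \<ge> 1 \<Longrightarrow> real (s n) - 1 \<le> x n"
    and eq: "\<And>n. n \<ge> 1 \<Longrightarrow> x n gchoose s n = real (num_antichains n (s n))"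
  shows "(\<lambda>n. x n / real (central_binom n) - real t) \<longlonglongrightarrow> 0"
proof (rule tendstoI)
  fix e :: real assume e: "e > 0"
  \<comment> \<open>Keeping \<open>\<delta>\<close> below \<open>t\<close> makes the lower bound
    applicable and lets \<open>(t - \<delta>) m\<close> eventually dominate
    \<open>s\<close>.\<close>
  define \<delta> where "\<delta> = min (e / 2) (real t / 2)"
  have \<delta>: "0 < \<delta>" "\<delta> < real t" "\<delta> < e" using e t by (auto simp: \<delta>_def)
  have "\<forall>\<^sub>F n in sequentially. real (s n) \<le> (real t - \<delta>) * real (central_binom n)"
    using \<delta> by (intro eventually_s_le) simp
  then show "\<forall>\<^sub>F n in sequentially. dist (x n / real (central_binom n) - real t) 0 < e"
    using eventually_num_antichains_ge[OF \<delta>(1) less_imp_le[OF \<delta>(2)]]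
      eventually_num_antichains_le[OF \<delta>(1)] eventually_ge_at_top[of 1]
  proof eventually_elim
    case (elim n)
    let ?m = "real (central_binom n)"
    have s0: "s n > 0" using s elim(4) by simp
    have "(real t - \<delta>) * ?m \<le> x n"
      using elim(2) eq[OF elim(4)] by (intro gbinomial_le_cancel[OF s0 x[OF elim(4)]]) simp
    moreover have "x n \<le> (real t + \<delta>) * ?m"
    proof (rule gbinomial_le_cancel[OF s0])
      have "(real t - \<delta>) * ?m \<le> (real t + \<delta>) * ?m" using \<delta> by (intro mult_right_mono) auto
      then show "real (s n) - 1 \<le> (real t + \<delta>) * ?m" using elim(1) by linarith
    qed (use elim(3) eq[OF elim(4)] in simp)
    ultimately have "real t - \<delta> \<le> x n / ?m" "x n / ?m \<le> real t + \<delta>"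
      by (simp_all add: le_divide_eq divide_le_eq)
    then show ?case using \<delta> by (simp add: dist_real_def)
  qed
qed

end

theorem proposition3:
  fixes t :: nat and s :: "nat \<Rightarrow> nat"
  assumes "t \<ge> 1"
    and "\<And>n. n \<ge> 1 \<Longrightarrow> s n > 0"
    and "much_less (\<lambda>n. real (central_binom n) / real n ^ t) (\<lambda>n. real (s n))"
    and "much_less (\<lambda>n. real (s n)) (\<lambda>n. real (central_binom n) / real n ^ (t - 1))"
  shows "(\<exists>\<epsilon> :: nat \<Rightarrow> real. \<epsilon> \<longlonglongrightarrow> 0 \<and>
            (\<forall>n\<ge>1. real (num_antichains n (s n)) =
               ((real t + \<epsilon> n) * real (central_binom n)) gchoose s n))
       \<and> (\<forall>\<delta> :: real. \<delta> > 0 \<longrightarrow>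
            (\<forall>\<^sub>F n in sequentially.
               (\<delta> \<le> real t \<longrightarrow>
                  ((real t - \<delta>) * real (central_binom n)) gchoose s n
                    \<le> real (num_antichains n (s n))) \<and>
               real (num_antichains n (s n))
                 \<le> ((real t + \<delta>) * real (central_binom n)) gchoose s n))"
proof (intro conjI allI impI)
  \<comment> \<open>Solving for the upper argument turns the asymptotic bounds into an exact
    identity; the error term is then \<open>x n / m - t\<close>.\<close>
  have "\<exists>x. n \<ge> 1 \<longrightarrow> real (s n) - 1 \<le> x \<and> x gchoose s n = real (num_antichains n (s n))" for n
  proof (cases "n \<ge> 1")
    case True
    then show ?thesis using gbinomial_surj[OF assms(2), of n "real (num_antichains n (s n))"] by force
  qed simp
  then obtain x where x: "\<And>n. n \<ge> 1 \<Longrightarrow> real (s n) - 1 \<le> x n"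
      "\<And>n. n \<ge> 1 \<Longrightarrow> x n gchoose s n = real (num_antichains n (s n))"
    by metis
  have "(\<lambda>n. x n / real (central_binom n) - real t) \<longlonglongrightarrow> 0"
    by (rule gbinomial_parameter_tendsto[OF assms x])
  moreover have "(real t + (x n / real (central_binom n) - real t)) * real (central_binom n) = x n" for n
    by simp
  ultimately show "\<exists>\<epsilon> :: nat \<Rightarrow> real. \<epsilon> \<longlonglongrightarrow> 0 \<and> (\<forall>n\<ge>1. real (num_antichains n (s n)) =
      ((real t + \<epsilon> n) * real (central_binom n)) gchoose s n)"
    using x(2) by (intro exI[of _ "\<lambda>n. x n / real (central_binom n) - real t"]) simp
next
  fix \<delta> :: real assume \<delta>: "\<delta> > 0"
  have "\<forall>\<^sub>F n in sequentially. \<delta> \<le> real t \<longrightarrow> ((real t - \<delta>) * real (central_binom n)) gchoose s n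
      \<le> real (num_antichains n (s n))"
    using eventually_num_antichains_ge[OF assms \<delta>] by (cases "\<delta> \<le> real t") auto
  then show "\<forall>\<^sub>F n in sequentially. (\<delta> \<le> real t \<longrightarrow>
        ((real t - \<delta>) * real (central_binom n)) gchoose s n \<le> real (num_antichains n (s n))) \<and>
      real (num_antichains n (s n)) \<le> ((real t + \<delta>) * real (central_binom n)) gchoose s n"
    using eventually_num_antichains_le[OF assms \<delta>] by (rule eventually_conj)
qed

end
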